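(* Let $p,q\in\mathcal{G}$ be the probability mass functions of the random variables $X\sim p$ and $Y\sim q$, with supports $S_p=\{0,\ldots,M\}$ and $S_q=\{0,\ldots,N\}$, $0\le N\le M\le\infty$ (so that $S_q\subseteq S_p$), and suppose that $\mathcal{F}^{+}(p)\cap\mathcal{F}^{+}(q)\neq\emptyset$. Let $\mathcal{H}$ be a class of functions $l:\mathbb{Z}\to\mathbb{R}$ for which ${\rm E}_p[l(X)]$ and ${\rm E}_q[l(Y)]$ exist, and let $$d_{\mathcal{H}}(X,Y)=\sup_{l\in\mathcal{H}}\left|{\rm E}_q[l(Y)]-{\rm E}_p[l(X)]\right|.$$ For $l\in\mathcal{H}$ let $f_l^{p,+}:\mathbb{Z}\to\mathbb{R}$ be given by $$f_l^{p,+}(x)=\frac{1}{p(x)}\sum_{k=0}^{x-1}\bigl(l(k)-{\rm E}_p[l(X)]\bigr)p(k),$$ and suppose that for all $l\in\mathcal{H}$ this function exists and satisfies $f_l^{p,+}\in\mathcal{F}^{+}(p)\cap\mathcal{F}^{+}(q)$. Then $$d_{\mathcal{H}}(X,Y)\le\kappa_{\mathcal{H}}^{p,+}\sqrt{\mathcal{K}_{\rm gen}(X,Y)},$$ where $$\kappa_{\mathcal{H}}^{p,+}:=\sup_{l\in\mathcal{H}}\sqrt{{\rm E}_q\left[\left(f_l^{p,+}(Y+1)\frac{p(Y+1)}{p(Y)}\right)^2\right]}$$ and $$\mathcal{K}_{\rm gen}(X,Y)={\rm E}_q\left[\left(\frac{p(Y)\,q(Y+1)}{p(Y+1)\,q(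Y)}-1\right)^2\right].$$
   Context: $\mathcal{G}$ is the collection of probability mass functions $p:\mathbb{Z}\to[0,1]$ whose support $S_p:=\{x\in\mathbb{Z}:p(x)>0\}$ is a discrete interval $[a,b]:=\{a,a+1,\ldots,b\}$ with $a<b$, $a,b\in\mathbb{Z}\cup\{\pm\infty\}$ (infinite endpoints are not elements of the interval). Conventions: sums over empty index sets equal $0$, and $1/p(x)$ is understood to be $0$ when $x\notin S_p$ (for every $p\in\mathcal{G}$). For $p\in\mathcal{G}$, ${\rm E}_p[l(X)]=\sum_{x\in S_p}l(x)p(x)$ for $p$-summable $l$. Forward difference operator: $\Delta^{+}h(x)=h(x+1)-h(x)$ for $h:\mathbb{Z}\to\mathbb{R}$. For $p\in\mathcal{G}$ with support $[a,b]$, $\mathcal{F}^{+}(p)$ is the collection of functions $f:\mathbb{Z}\to\mathbb{R}$ such that $\sum_{j=a}^{b}\Delta^{+}(f(j)p(j))=0$ (meaning that $j\mapsto\Delta^{+}(f(j)p(j))$ is summable over $[a,b]$ with sum $0$). *)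

theory Defs
  imports "HOL-Probability.Probability" "HOL-Library.Extended"
begin

text \<open>
  The endpoints of a discrete interval live in the integers extended by \<^const>\<open>Minf\<close> and
  \<^const>\<open>Pinf\<close>, whereas the interval itself only contains integers.
\<close>

definition discrete_interval :: "int extended \<Rightarrow> int extended \<Rightarrow> int set" where
  "discrete_interval a b = {x. a \<le> Fin x \<and> Fin x \<le> b}"

definition interval_pmfs :: "int pmf set" where
  "interval_pmfs = {p. \<exists>a b. a < b \<and> set_pmf p = discrete_interval a b}"

definition fwd_diff :: "(int \<Rightarrow> real) \<Rightarrow> int \<Rightarrow> real" where
  "fwd_diff h x = h (x + 1) - h x"

text \<open>Summability over a (possibly infinite) support is unconditional summability.\<close>

definition stein_class :: "int pmf \<Rightarrow> (int \<Rightarrow> real) set" where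
  "stein_class p = {f. (fwd_diff (\<lambda>j. f j * pmf p j) has_sum 0) (set_pmf p)}"

text \<open>
  For a mass function supported on an interval starting at 0. As \<^term>\<open>pmf p x = 0\<close> off the
  support and \<^prop>\<open>1 / (0::real) = 0\<close> in HOL, the convention that \<open>1 / p x\<close> vanishes off the
  support of \<open>p\<close> is automatic, here and in the ratios below.
\<close>

definition stein_solution :: "int pmf \<Rightarrow> (int \<Rightarrow> real) \<Rightarrow> int \<Rightarrow> real" where
  "stein_solution p l x =
     1 / pmf p x * (\<Sum>k = 0..x - 1. (l k - measure_pmf.expectation p l) * pmf p k)"

text \<open>
  The three quantities below may be infinite, hence take values in \<^typ>\<open>ennreal\<close>
  (where \<^prop>\<open>0 * top = (0::ennreal)\<close>). They depend on the random variables \<open>X\<close> and \<open>Y\<close>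
  only through their laws \<open>p\<close> and \<open>q\<close>. Expectations of squares are nonnegative integrals.
\<close>

definition ennreal_root2 :: "ennreal \<Rightarrow> ennreal" where
  "ennreal_root2 x = (if x = top then top else ennreal (sqrt (enn2real x)))"

definition ipm_dist :: "(int \<Rightarrow> real) set \<Rightarrow> int pmf \<Rightarrow> int pmf \<Rightarrow> ennreal" where
  "ipm_dist H p q =
     (SUP l\<in>H. ennreal \<bar>measure_pmf.expectation q l - measure_pmf.expectation p l\<bar>)"

definition stein_kappa :: "(int \<Rightarrow> real) set \<Rightarrow> int pmf \<Rightarrow> int pmf \<Rightarrow> ennreal" where
  "stein_kappa H p q =
     (SUP l\<in>H. ennreal_root2
        (\<integral>\<^sup>+ y. ennreal ((stein_solution p l (y + 1) * (pmf p (y + 1) / pmf p y))\<^sup>2)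
           \<partial>measure_pmf q))"

definition K_gen :: "int pmf \<Rightarrow> int pmf \<Rightarrow> ennreal" where
  "K_gen p q =
     (\<integral>\<^sup>+ y. ennreal ((pmf p y * pmf q (y + 1) / (pmf p (y + 1) * pmf q y) - 1)\<^sup>2)
        \<partial>measure_pmf q)"

end

theory Submission
  imports Defs
begin

text \<open>
  Write \<open>f\<close> for the Stein solution attached to \<open>l\<close>. The product \<open>f p\<close> telescopes:
  \<open>\<Delta>\<^sup>+(f p) = (l - E\<^sub>p l) p\<close> on the support of \<open>p\<close>. Dividing by \<open>p\<close> and integrating against \<open>q\<close>
  expresses \<open>E\<^sub>q l - E\<^sub>p l\<close> through \<open>\<Delta>\<^sup>+(f p)\<close>; subtracting the vanishing sum of \<open>\<Delta>\<^sup>+(f q)\<close> cancels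
  the terms in \<open>f y\<close> and leaves the \<open>q\<close>-mean of \<open>A (1 - B)\<close>, where \<open>A y = f (y+1) p (y+1) / p y\<close>
  and \<open>B y = p y q (y+1) / (p (y+1) q y)\<close>. The Cauchy--Schwarz inequality concludes.
\<close>

text \<open>\<open>measure_pmf q\<close> has density \<open>pmf q\<close> against counting measure:
  dividing \<open>h\<close> by \<open>pmf q\<close> cancels this weight on the support, and off it
  the weight is 0. Since unconditional and absolute summability agree for reals, the sums in
  \<open>stein_class\<close> become Bochner integrals.\<close>

lemma has_bochner_integral_measure_pmf:
  fixes h :: "'a \<Rightarrow> real"
  assumes "(h has_sum s) (set_pmf q)"
  shows "has_bochner_integral (measure_pmf q) (\<lambda>x. h x / pmf q x) s"
proof -
  have sum: "Infinite_Set_Sum.abs_summable_on h (set_pmf q)"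
    using assms has_sum_imp_summable summable_on_iff_abs_summable_on_real abs_summable_equivalent
    by blast
  have eq: "pmf q x *\<^sub>R (h x / pmf q x) = indicator (set_pmf q) x *\<^sub>R h x" for x
    by (auto simp: set_pmf_iff indicator_def)
  have "integrable (measure_pmf q) (\<lambda>x. h x / pmf q x)"
    unfolding measure_pmf_eq_density
    by (subst integrable_density)
      (use sum in \<open>auto simp only: eq abs_summable_on_altdef set_integrable_def
        simp: pmf_nonneg measurable_count_space_eq1 space_borel\<close>)
  moreover have "(\<integral>x. h x / pmf q x \<partial>measure_pmf q) = infsetsum h (set_pmf q)"
    unfolding measure_pmf_eq_density
    by (subst integral_density)
      (auto simp only: eq infsetsum_altdef set_lebesgue_integral_def
        simp: pmf_nonneg measurable_count_space_eq1 space_borel)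
  moreover have "infsetsum h (set_pmf q) = s"
    using infsetsum_infsum[OF sum] infsumI[OF assms] by simp
  ultimately show ?thesis
    by (simp add: has_bochner_integral_iff)
qed

lemma ennreal_root2_square: "(ennreal_root2 x)\<^sup>2 = x"
  by (cases x) (auto simp: ennreal_root2_def ennreal_power power2_eq_square simp flip: ennreal_mult)

lemma power2_le_imp_le_ennreal:
  fixes a b :: ennreal
  assumes "a\<^sup>2 \<le> b\<^sup>2"
  shows "a \<le> b"
proof (cases a; cases b)
  fix r s assume "a = ennreal r" "0 \<le> r" "b = ennreal s" "0 \<le> s"
  then show ?thesis
    using assms by (auto simp: ennreal_power intro: power2_le_imp_le)
qed (use assms in \<open>auto simp: ennreal_power top_unique power_eq_top_ennreal\<close>)

text \<open>Squaring removes the roots and leaves the usual Cauchy-Schwarz inequality. Staying in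
  \<open>ennreal\<close> allows either integral to be infinite.\<close>

lemma Cauchy_Schwarz_root2:
  fixes f g :: "'a \<Rightarrow> real"
  assumes [measurable]: "f \<in> borel_measurable M" "g \<in> borel_measurable M"
  shows "(\<integral>\<^sup>+x. ennreal \<bar>f x * g x\<bar> \<partial>M)
    \<le> ennreal_root2 (\<integral>\<^sup>+x. ennreal ((f x)\<^sup>2) \<partial>M) * ennreal_root2 (\<integral>\<^sup>+x. ennreal ((g x)\<^sup>2) \<partial>M)"
proof (rule power2_le_imp_le_ennreal)
  show "(\<integral>\<^sup>+x. ennreal \<bar>f x * g x\<bar> \<partial>M)\<^sup>2
    \<le> (ennreal_root2 (\<integral>\<^sup>+x. ennreal ((f x)\<^sup>2) \<partial>M)
      * ennreal_root2 (\<integral>\<^sup>+x. ennreal ((g x)\<^sup>2) \<partial>M))\<^sup>2"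
    using Cauchy_Schwarz_nn_integral[of "\<lambda>x. ennreal \<bar>f x\<bar>" M "\<lambda>x. ennreal \<bar>g x\<bar>"]
    by (simp add: power_mult_distrib ennreal_root2_square ennreal_power abs_mult ennreal_mult)
qed

lemma sum_centred_eq_0:
  fixes l :: "'a \<Rightarrow> real"
  assumes "finite (set_pmf p)"
  shows "(\<Sum>k\<in>set_pmf p. (l k - measure_pmf.expectation p l) * pmf p k) = 0"
proof -
  have "(\<Sum>k\<in>set_pmf p. l k * pmf p k) = measure_pmf.expectation p l"
    using assms by (intro integral_measure_pmf_real[symmetric]) auto
  moreover have "(\<Sum>k\<in>set_pmf p. pmf p k) = 1"
    using assms by (intro sum_pmf_eq_1) auto
  ultimately show ?thesis
    by (simp add: left_diff_distrib sum_subtractf flip: sum_distrib_left)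
qed

lemma mem_discrete_interval:
  "x \<in> discrete_interval (Fin 0) M \<longleftrightarrow> 0 \<le> x \<and> Fin x \<le> M"
  by (simp add: discrete_interval_def)

text \<open>
  At the right endpoint \<open>x\<close> of the support the left-hand side is 0 since \<open>p (x + 1) = 0\<close>; the
  identity persists because the sum on the right is then the total centred sum.
\<close>

lemma stein_solution_mult_pmf:
  assumes p: "set_pmf p = discrete_interval (Fin 0) M" and x: "x \<in> set_pmf p"
  shows "stein_solution p l (x + 1) * pmf p (x + 1)
    = (\<Sum>k = 0..x. (l k - measure_pmf.expectation p l) * pmf p k)"
proof (cases "x + 1 \<in> set_pmf p")
  case True
  then show ?thesis by (simp add: stein_solution_def set_pmf_iff)
next
  case False
  \<comment> \<open>An interval that contains \<open>x\<close> but not \<open>x + 1\<close> ends at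
    \<open>x\<close>, so the support is finite and the sum runs over all of it.\<close>
  have "set_pmf p = {0..x}"
  proof (intro set_eqI iffI)
    fix y assume "y \<in> set_pmf p"
    then show "y \<in> {0..x}"
      using False x unfolding p mem_discrete_interval by (cases M) auto
  next
    fix y assume "y \<in> {0..x}"
    then show "y \<in> set_pmf p"
      using x unfolding p mem_discrete_interval by (cases M) auto
  qed
  moreover have "pmf p (x + 1) = 0" using False by (simp add: set_pmf_iff)
  ultimately show ?thesis using sum_centred_eq_0[of p l] by simp
qed

text \<open>Consecutive partial sums differ in their last term; at the left endpoint
  \<open>x = 0\<close> the earlier sum is empty.\<close>

lemma fwd_diff_stein_solution:
  assumes p: "set_pmf p = discrete_interval (Fin 0) M" and x: "x \<in> set_pmf p"
  shows "fwd_diff (\<lambda>j. stein_solution p l j * pmf p j) x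
    = (l x - measure_pmf.expectation p l) * pmf p x"
proof -
  have "0 \<le> x" using x by (simp add: p mem_discrete_interval)
  then have "{0..x} = insert x {0..x - 1}" by auto
  moreover have "stein_solution p l x * pmf p x
    = (\<Sum>k = 0..x - 1. (l k - measure_pmf.expectation p l) * pmf p k)"
    using x by (simp add: stein_solution_def set_pmf_iff)
  ultimately show ?thesis
    unfolding fwd_diff_def stein_solution_mult_pmf[OF p x] by simp
qed

text \<open>The estimate for one test function, from which the theorem follows by taking suprema
  over \<open>H\<close>.\<close>

lemma expectation_diff_le_stein:
  assumes p: "set_pmf p = discrete_interval (Fin 0) M" and sub: "set_pmf q \<subseteq> set_pmf p"
    and l: "integrable (measure_pmf q) l" and f: "stein_solution p l \<in> stein_class q"
  shows "ennreal \<bar>measure_pmf.expectation q l - measure_pmf.expectation p l\<bar>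
    \<le> ennreal_root2
        (\<integral>\<^sup>+ y. ennreal ((stein_solution p l (y + 1) * (pmf p (y + 1) / pmf p y))\<^sup>2)
           \<partial>measure_pmf q) * ennreal_root2 (K_gen p q)"
proof -
  let ?f = "stein_solution p l" and ?c = "measure_pmf.expectation p l"
  let ?A = "\<lambda>y. ?f (y + 1) * (pmf p (y + 1) / pmf p y)"
  \<comment> \<open>\<open>?B\<close> already contains the \<open>- 1\<close>, as in
    \<open>K_gen\<close>, so \<open>?A * ?B\<close> integrates to the negative of the difference of
    expectations; the absolute value absorbs the sign.\<close>
  let ?B = "\<lambda>y. pmf p y * pmf q (y + 1) / (pmf p (y + 1) * pmf q y) - 1"
  have "has_bochner_integral (measure_pmf q) (\<lambda>y. fwd_diff (\<lambda>j. ?f j * pmf q j) y / pmf q y) 0"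
    using f by (intro has_bochner_integral_measure_pmf) (simp add: stein_class_def)
  moreover have "has_bochner_integral (measure_pmf q) (\<lambda>y. l y - ?c)
      (measure_pmf.expectation q l - ?c)"
    using l by (simp add: has_bochner_integral_iff)
  ultimately have "has_bochner_integral (measure_pmf q)
      (\<lambda>y. fwd_diff (\<lambda>j. ?f j * pmf q j) y / pmf q y - (l y - ?c))
      (0 - (measure_pmf.expectation q l - ?c))"
    by (rule has_bochner_integral_diff)
  moreover have "fwd_diff (\<lambda>j. ?f j * pmf q j) y / pmf q y - (l y - ?c) = ?A y * ?B y"
    if y: "y \<in> set_pmf q" for y
  proof -
    have nz: "pmf p y \<noteq> 0" "pmf q y \<noteq> 0" using y sub by (auto simp: set_pmf_iff)
    have "l y - ?c = ?f (y + 1) * pmf p (y + 1) / pmf p y - ?f y"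
      using fwd_diff_stein_solution[OF p, of y l] y sub nz by (auto simp: fwd_diff_def field_simps)
    moreover have "fwd_diff (\<lambda>j. ?f j * pmf q j) y / pmf q y
        = ?f (y + 1) * pmf q (y + 1) / pmf q y - ?f y"
      using nz by (simp add: fwd_diff_def diff_divide_distrib)
    moreover have "?A y * ?B y
        = ?f (y + 1) * pmf q (y + 1) / pmf q y - ?f (y + 1) * pmf p (y + 1) / pmf p y"
    \<comment> \<open>If \<open>p\<close> vanishes at \<open>y + 1\<close>, the ratio in
      \<open>?B\<close> is 0 by convention and cancelling is impossible; the factor
      \<open>1 / pmf p (y + 1)\<close> in \<open>?f (y + 1)\<close> then makes every term 0.\<close>
    proof (cases "pmf p (y + 1) = 0")
      case True
      then have "?f (y + 1) = 0" by (simp add: stein_solution_def)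
      then show ?thesis by simp
    qed (use nz in \<open>simp add: field_simps\<close>)
    ultimately show ?thesis by simp
  qed
  \<comment> \<open>The pointwise identity is known on the support of \<open>q\<close> only, which
    carries all the mass.\<close>
  ultimately have "has_bochner_integral (measure_pmf q) (\<lambda>y. ?A y * ?B y)
      (0 - (measure_pmf.expectation q l - ?c))"
    by (subst (asm) has_bochner_integral_cong_AE[where g = "\<lambda>y. ?A y * ?B y"])
      (auto simp: AE_measure_pmf_iff)
  then have "ennreal \<bar>measure_pmf.expectation q l - ?c\<bar>
      \<le> (\<integral>\<^sup>+ y. ennreal \<bar>?A y * ?B y\<bar> \<partial>measure_pmf q)"
    using integral_norm_bound_ennreal[of "measure_pmf q" "\<lambda>y. ?A y * ?B y"]
    by (simp add: has_bochner_integral_iff abs_minus_commute)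
  also have "\<dots> \<le> ennreal_root2 (\<integral>\<^sup>+ y. ennreal ((?A y)\<^sup>2) \<partial>measure_pmf q)
      * ennreal_root2 (\<integral>\<^sup>+ y. ennreal ((?B y)\<^sup>2) \<partial>measure_pmf q)"
    by (intro Cauchy_Schwarz_root2) auto
  finally show ?thesis
    unfolding K_gen_def .
qed

theorem theorem3p2:
  fixes p q :: "int pmf"
    and M N :: "int extended"
    and H :: "(int \<Rightarrow> real) set"
  assumes "p \<in> interval_pmfs" and "q \<in> interval_pmfs"
    and "set_pmf p = discrete_interval (Fin 0) M"
    and "set_pmf q = discrete_interval (Fin 0) N"
    and "Fin 0 \<le> N" and "N \<le> M"
    and "stein_class p \<inter> stein_class q \<noteq> {}"
    and "\<And>l. l \<in> H \<Longrightarrow> integrable (measure_pmf p) l"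
    and "\<And>l. l \<in> H \<Longrightarrow> integrable (measure_pmf q) l"
    and "\<And>l. l \<in> H \<Longrightarrow> stein_solution p l \<in> stein_class p \<inter> stein_class q"
  shows "ipm_dist H p q \<le> stein_kappa H p q * ennreal_root2 (K_gen p q)"
proof -
  have sub: "set_pmf q \<subseteq> set_pmf p"
    using assms(3,4,6) by (auto simp: mem_discrete_interval)
  show ?thesis
    unfolding ipm_dist_def
  proof (rule SUP_least)
    fix l assume "l \<in> H"
    then have "ennreal \<bar>measure_pmf.expectation q l - measure_pmf.expectation p l\<bar>
        \<le> ennreal_root2
            (\<integral>\<^sup>+ y. ennreal ((stein_solution p l (y + 1) * (pmf p (y + 1) / pmf p y))\<^sup>2)
               \<partial>measure_pmf q) * ennreal_root2 (K_gen p q)"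
      using assms(9,10) by (intro expectation_diff_le_stein[OF assms(3) sub]) auto
    \<comment> \<open>\<open>K_gen p q\<close> is independent of \<open>l\<close>, so only the first
      factor is replaced by its supremum.\<close>
    also have "\<dots> \<le> stein_kappa H p q * ennreal_root2 (K_gen p q)"
      unfolding stein_kappa_def using \<open>l \<in> H\<close> by (intro mult_right_mono SUP_upper) auto
    finally show "ennreal \<bar>measure_pmf.expectation q l - measure_pmf.expectation p l\<bar>
        \<le> stein_kappa H p q * ennreal_root2 (K_gen p q)" .
  qed
qed

end
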